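(* Let $d\ge 1$ be an integer, $p\ge 1$ a real number and $\alpha\in(0,1)$. Let $P$ be the uniform distribution on the unit cube $[0,1]^d$, let $X_1,X_2,\ldots$ be i.i.d. random vectors with common law $P$, and for each $n\ge1$ let $P_n=\frac1n\sum_{i=1}^n\delta_{X_i}$ be the empirical measure on $X_1,\ldots,X_n$. Then \[ \mathcal{W}_p\bigl(\mathcal{R}_\alpha(P_n),P\bigr)=O_P\bigl(n^{-1/d}\bigr)\qquad (n\to\infty), \] that is, for every $\varepsilon>0$ there exist $M<\infty$ and $n_0$ such that $\Pr\bigl(n^{1/d}\,\mathcal{W}_p(\mathcal{R}_\alpha(P_n),P)>M\bigr)\le\varepsilon$ for all $n\ge n_0$.
   Context: $\delta_x$ is the Dirac measure at $x$ and $\|\cdot\|$ is the Euclidean norm. For $0\le\alpha<1$ and a Borel probability measure $P$ on $\mathbb{R}^d$, $\mathcal{R}_\alpha(P)$ denotes the set of $\alpha$-trimmings of $P$: all Borel probability measures $R$ on $\mathbb{R}^d$ that are absolutely continuous with respect to $P$ with $\frac{dR}{dP}\le\frac1{1-\alpha}$ ($P$-almost surely). For $p\ge1$ the $L_p$-Wasserstein distance is $\mathcal{W}_p(P,Q)=\bigl(\inf_{\tau\in\mathcal{M}(P,Q)}\int\|x-y\|^p\,d\tau(x,y)\bigr)^{1/p}$, where $\mathcal{M}(P,Q)$ is the set of probability measures on $\mathbb{R}^d\times\mathbb{R}^d$ with marginals $P$ and $Q$. The cost of optimal incomplete transportation is $\mathcal{W}_p(\mathcal{R}_\alpha(P),Q)=\min_{R\in\mathcal{R}_\alpha(P)}\mathcal{W}_p(R,Q)$.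 *)

theory Defs
  imports "HOL-Probability.Probability"
begin

text \<open>\<open>dR/dP\<close> is \<^term>\<open>RN_deriv P R\<close>; it is the genuine density only when \<open>R\<close> is absolutely
  continuous with respect to \<open>P\<close>, hence that conjunct.\<close>

definition trimmings :: "real \<Rightarrow> 'a::euclidean_space measure \<Rightarrow> 'a measure set" where
  "trimmings \<alpha> P =
     {R. prob_space R \<and> sets R = sets borel \<and> absolutely_continuous P R \<and>
         (AE x in P. RN_deriv P R x \<le> ennreal (1 / (1 - \<alpha>)))}"

definition couplings ::
  "'a::euclidean_space measure \<Rightarrow> 'a measure \<Rightarrow> ('a \<times> 'a) measure set" where
  "couplings P Q =
     {\<tau>. prob_space \<tau> \<and> sets \<tau> = sets (borel \<Otimes>\<^sub>M borel) \<and>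
         distr \<tau> borel fst = P \<and> distr \<tau> borel snd = Q}"

text \<open>The power \<open>x\<^sup>r\<close>, \<open>r > 0\<close>, on \<open>[0, \<infinity>]\<close>. Costs live in \<^typ>\<open>ennreal\<close>, so that an infinite
  cost is \<open>\<infinity>\<close> and not a default real value.\<close>

definition epowr :: "ennreal \<Rightarrow> real \<Rightarrow> ennreal" where
  "epowr x r = (if x = \<infinity> then \<infinity> else ennreal (enn2real x powr r))"

definition wasserstein ::
  "real \<Rightarrow> 'a::euclidean_space measure \<Rightarrow> 'a measure \<Rightarrow> ennreal" where
  "wasserstein p P Q =
     epowr (INF \<tau>\<in>couplings P Q. \<integral>\<^sup>+(x, y). ennreal (norm (x - y) powr p) \<partial>\<tau>) (1 / p)"

text \<open>Written as an infimum; the minimum, where attained, is the same value.\<close>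

definition trimmed_cost ::
  "real \<Rightarrow> real \<Rightarrow> 'a::euclidean_space measure \<Rightarrow> 'a measure \<Rightarrow> ennreal" where
  "trimmed_cost p \<alpha> P Q = (INF R\<in>trimmings \<alpha> P. wasserstein p R Q)"

text \<open>The points are indexed from 1. For \<open>n = 0\<close> this is the null measure.\<close>

definition empirical_measure :: "(nat \<Rightarrow> 'a::euclidean_space) \<Rightarrow> nat \<Rightarrow> 'a measure" where
  "empirical_measure x n =
     measure_of UNIV (sets borel)
       (\<lambda>A. ennreal (1 / real n) * (\<Sum>i=1..n. emeasure (return borel (x i)) A))"

lemma sets_empirical_measure [simp, measurable_cong]:
  "sets (empirical_measure x n) = sets borel"
  by (simp add: empirical_measure_def sets.sigma_sets_eq[of borel, simplified])

lemma space_empirical_measure [simp]: "space (empirical_measure x n) = UNIV"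
  by (simp add: empirical_measure_def)

lemma emeasure_empirical_measure:
  assumes "A \<in> sets borel"
  shows "emeasure (empirical_measure x n) A =
    ennreal (1 / real n) * (\<Sum>i=1..n. emeasure (return borel (x i)) A)"
proof (rule emeasure_measure_of[OF empirical_measure_def])
  let ?\<mu> = "\<lambda>A. ennreal (1 / real n) * (\<Sum>i=1..n. emeasure (return borel (x i)) A)"
  show "countably_additive (sets (empirical_measure x n)) ?\<mu>"
  proof (rule countably_additiveI)
    fix B :: "nat \<Rightarrow> 'a set"
    assume "range B \<subseteq> sets (empirical_measure x n)" "disjoint_family B"
    then have "emeasure (return borel (x i)) (\<Union>k. B k) =
        (\<Sum>k. emeasure (return borel (x i)) (B k))" for i
      by (intro suminf_emeasure[symmetric]) auto
    then show "(\<Sum>k. ?\<mu> (B k)) = ?\<mu> (\<Union>k. B k)"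
      by (simp add: suminf_sum)
  qed
qed (use assms in \<open>auto simp: positive_def\<close>)

lemma prob_space_empirical_measure:
  assumes "n \<ge> 1"
  shows "prob_space (empirical_measure x n)"
proof
  show "emeasure (empirical_measure x n) (space (empirical_measure x n)) = 1"
    using assms by (simp add: emeasure_empirical_measure ennreal_of_nat_eq_real_of_nat
        flip: ennreal_mult)
qed

end

theory Submission
  imports Defs
begin

text \<open>An \<open>\<alpha>\<close>-trimming may put mass up to \<open>1 / ((1 - \<alpha>) n)\<close> on each sample point. Read
the sample points as suppliers with this capacity: together they can ship
\<open>1 / (1 - \<alpha>) > 1\<close>, while the cube demands mass \<open>1\<close>. A plan that meets the demand of the
whole cube within the capacities is a coupling of a trimming of the empirical measure with the
uniform law, so the task is to find one of small cost (\<open>trimmed_cost_le_assignment\<close>).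

The surplus is what makes the rate \<open>n\<^sup>-\<^sup>1\<^sup>/\<^sup>d\<close> possible in every dimension, also for
\<open>d \<le> 2\<close>, where matching without trimming is slower. Divide the cube into dyadic cells. A
cell of side \<open>2\<^sup>-\<^sup>k\<close> has demand \<open>2\<^sup>-\<^sup>k\<^sup>d\<close> and expects \<open>n 2\<^sup>-\<^sup>k\<^sup>d\<close> sample
points; its capacity falls short of its demand only if the number of points in it is below
\<open>1 - \<alpha>\<close> times the mean. By Chernoff's bound this has probability at most
\<open>exp (- c n 2\<^sup>-\<^sup>k\<^sup>d)\<close> with \<open>c = \<alpha> + (1 - \<alpha>) ln (1 - \<alpha>) > 0\<close>
(\<open>expectation_cell_deficit_le\<close>).

Let \<open>2\<^sup>-\<^sup>L\<close> be the dyadic scale just above \<open>n\<^sup>-\<^sup>1\<^sup>/\<^sup>d\<close>. Ship as much as possible inside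
the cells of level \<open>L\<close>, then as much as possible of the rest inside the cells of level
\<open>L - 1\<close>, and so on up to the whole cube. After level \<open>k + 1\<close> each cell of that level has
either no unmet demand or no unused supply, so the unmet demand in it is the positive part of
demand minus capacity. Only this amount travels at level \<open>k\<close>, over a distance of order
\<open>2\<^sup>-\<^sup>k\<close> (\<open>hierarchical_plan\<close>, \<open>trimmed_cost_cube_le\<close>). Hence the expected cost is at
most a constant times
\[ 2^{-Lp} + \sum_{k < L} 2^{-kp} \exp (- c n 2^{-(k+1)d}) . \]
With \<open>u = n\<^sup>1\<^sup>/\<^sup>d / 2\<^sup>k\<^sup>+\<^sup>1\<close> a summand times \<open>n\<^sup>p\<^sup>/\<^sup>d\<close> is, up to a constant,
\<open>u\<^sup>p exp (- c u\<^sup>d)\<close>, which is at most a constant times \<open>1 / u\<close>, and the values of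
\<open>1 / u\<close> form a geometric series dominated by its last term (\<open>dyadic_cost_series_le\<close>). So the
expected \<open>p\<close>-th power of the distance is \<open>O (n\<^sup>-\<^sup>p\<^sup>/\<^sup>d)\<close>, and Markov's inequality finishes the
proof.\<close>

section \<open>Saturating a nested family of cells\<close>

text \<open>Suppliers \<open>I\<close> have capacities \<open>s\<close>, receivers \<open>C\<close> have demands \<open>m\<close>, and \<open>a i c\<close> is the mass
shipped from \<open>i\<close> to \<open>c\<close>. The maps \<open>g\<close> and \<open>h\<close> assign to suppliers and receivers the cell that
contains them. A plan that stays within cells is saturated if no cell contains both unused supply
and unmet demand, so nothing more can be shipped without leaving a cell.\<close>

definition partial_plan ::
  "'i set \<Rightarrow> 'c set \<Rightarrow> ('i \<Rightarrow> real) \<Rightarrow> ('c \<Rightarrow> real) \<Rightarrow> ('i \<Rightarrow> 'c \<Rightarrow> real) \<Rightarrow> bool" where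
  "partial_plan I C s m a \<longleftrightarrow>
     (\<forall>i\<in>I. \<forall>c\<in>C. 0 \<le> a i c) \<and>
     (\<forall>i\<in>I. (\<Sum>c\<in>C. a i c) \<le> s i) \<and>
     (\<forall>c\<in>C. (\<Sum>i\<in>I. a i c) \<le> m c)"

definition within_cells ::
  "'i set \<Rightarrow> 'c set \<Rightarrow> ('i \<Rightarrow> 'q) \<Rightarrow> ('c \<Rightarrow> 'q) \<Rightarrow> ('i \<Rightarrow> 'c \<Rightarrow> real) \<Rightarrow> bool" where
  "within_cells I C g h a \<longleftrightarrow> (\<forall>i\<in>I. \<forall>c\<in>C. a i c \<noteq> 0 \<longrightarrow> g i = h c)"

definition saturated ::
  "'i set \<Rightarrow> 'c set \<Rightarrow> ('i \<Rightarrow> real) \<Rightarrow> ('c \<Rightarrow> real) \<Rightarrow> ('i \<Rightarrow> 'q) \<Rightarrow> ('c \<Rightarrow> 'q) \<Rightarrow>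
     ('i \<Rightarrow> 'c \<Rightarrow> real) \<Rightarrow> bool" where
  "saturated I C s m g h a \<longleftrightarrow>
     (\<forall>i\<in>I. \<forall>c\<in>C. g i = h c \<longrightarrow> (\<Sum>c\<in>C. a i c) = s i \<or> (\<Sum>i\<in>I. a i c) = m c)"

text \<open>Let a cell have total unused supply \<open>R\<close> and total unmet demand \<open>U\<close>. Shipping the product plan
\<open>r i * u c / max R U\<close> on top of \<open>a\<close> uses up the smaller of the two: all supply if
\<open>R \<le> U\<close>, and all demand otherwise. The added mass is at most the unmet demand, which
gives the bound on the cost.\<close>

lemma extend_plan:
  fixes a w :: "'i \<Rightarrow> 'c \<Rightarrow> real" and g :: "'i \<Rightarrow> 'q" and h :: "'c \<Rightarrow> 'q"
  assumes fin: "finite I" "finite C"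
    and plan: "partial_plan I C s m a"
    and cells: "within_cells I C g h a"
    and cost: "\<And>i c. i \<in> I \<Longrightarrow> c \<in> C \<Longrightarrow> g i = h c \<Longrightarrow> w i c \<le> \<delta>"
    and "0 \<le> \<delta>"
  obtains a' where "partial_plan I C s m a'" "within_cells I C g h a'" "saturated I C s m g h a'"
    "(\<Sum>i\<in>I. \<Sum>c\<in>C. a' i c * w i c) \<le>
       (\<Sum>i\<in>I. \<Sum>c\<in>C. a i c * w i c) + \<delta> * (\<Sum>c\<in>C. m c - (\<Sum>i\<in>I. a i c))"
proof -
  define r where "r i = s i - (\<Sum>c\<in>C. a i c)" for i
  define u where "u c = m c - (\<Sum>i\<in>I. a i c)" for c
  define R where "R q = (\<Sum>i\<in>{i\<in>I. g i = q}. r i)" for q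
  define U where "U q = (\<Sum>c\<in>{c\<in>C. h c = q}. u c)" for q
  \<comment> \<open>If \<open>R\<close> and \<open>U\<close> both vanish on a cell, the quotient is \<open>0\<close>, as it should be: nothing is
    left to ship there.\<close>
  define e where "e i c = (if g i = h c then r i * u c / max (R (h c)) (U (h c)) else 0)" for i c
  have r0: "r i \<ge> 0" if "i \<in> I" for i using plan that by (auto simp: partial_plan_def r_def)
  have u0: "u c \<ge> 0" if "c \<in> C" for c using plan that by (auto simp: partial_plan_def u_def)
  have R0: "R q \<ge> 0" and U0: "U q \<ge> 0" for q
    unfolding R_def U_def using r0 u0 by (auto intro!: sum_nonneg)
  have rR: "r i \<le> R (g i)" if "i \<in> I" for i
    unfolding R_def using fin r0 that by (intro member_le_sum) auto
  have uU: "u c \<le> U (h c)" if "c \<in> C" for c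
    unfolding U_def using fin u0 that by (intro member_le_sum) auto
  have e0: "e i c \<ge> 0" if "i \<in> I" "c \<in> C" for i c
    using r0 u0 R0[of "h c"] that by (auto simp: e_def intro!: divide_nonneg_nonneg)
  have row: "(\<Sum>c\<in>C. e i c) = r i * (U (g i) / max (R (g i)) (U (g i)))" for i
  proof -
    have "(\<Sum>c\<in>C. e i c) = (\<Sum>c\<in>{c\<in>C. h c = g i}. r i * u c / max (R (g i)) (U (g i)))"
      using fin by (intro sum.mono_neutral_cong_right) (auto simp: e_def)
    also have "\<dots> = r i * (U (g i) / max (R (g i)) (U (g i)))"
      by (simp add: U_def sum_distrib_left sum_divide_distrib)
    finally show ?thesis .
  qed
  have col: "(\<Sum>i\<in>I. e i c) = u c * (R (h c) / max (R (h c)) (U (h c)))" for c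
  proof -
    have "(\<Sum>i\<in>I. e i c) = (\<Sum>i\<in>{i\<in>I. g i = h c}. u c * r i / max (R (h c)) (U (h c)))"
      using fin by (intro sum.mono_neutral_cong_right) (auto simp: e_def)
    also have "\<dots> = u c * (R (h c) / max (R (h c)) (U (h c)))"
      by (simp add: R_def sum_distrib_left sum_divide_distrib)
    finally show ?thesis .
  qed
  have ratio: "x / max x y \<le> 1" "y / max x y \<le> 1" if "x \<ge> 0" "y \<ge> 0" for x y :: real
    using that by (auto simp: divide_le_eq_1 max_def)
  have rows: "(\<Sum>c\<in>C. e i c) \<le> r i" if "i \<in> I" for i
    unfolding row using r0[OF that] ratio(2)[OF R0 U0] by (rule mult_left_le[rotated])
  have cols: "(\<Sum>i\<in>I. e i c) \<le> u c" if "c \<in> C" for c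
    unfolding col using u0[OF that] ratio(1)[OF R0 U0] by (rule mult_left_le[rotated])
  define a' where "a' i c = a i c + e i c" for i c
  show thesis
  proof (rule that)
    show "partial_plan I C s m a'"
      using plan e0 rows cols
      unfolding partial_plan_def a'_def sum.distrib r_def u_def by (auto simp: algebra_simps)
    show "within_cells I C g h a'"
      using cells by (auto simp: within_cells_def a'_def e_def)
    show "saturated I C s m g h a'"
      unfolding saturated_def
    proof (intro ballI impI)
      fix i c assume ic: "i \<in> I" "c \<in> C" "g i = h c"
      show "(\<Sum>c\<in>C. a' i c) = s i \<or> (\<Sum>i\<in>I. a' i c) = m c"
      proof (cases "R (h c) \<le> U (h c)")
        case True
        then have "(\<Sum>c\<in>C. e i c) = r i"
          using rR[OF ic(1)] r0[OF ic(1)] ic(3) by (cases "U (h c) = 0") (auto simp: row max_def)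
        then show ?thesis by (simp add: a'_def sum.distrib r_def)
      next
        case False
        then have "(\<Sum>i\<in>I. e i c) = u c"
          using U0[of "h c"] by (auto simp: col max_def)
        then show ?thesis by (simp add: a'_def sum.distrib u_def)
      qed
    qed
    have "(\<Sum>i\<in>I. \<Sum>c\<in>C. e i c * w i c) \<le> (\<Sum>i\<in>I. \<Sum>c\<in>C. e i c * \<delta>)"
    proof (intro sum_mono)
      fix i c assume "i \<in> I" "c \<in> C"
      then show "e i c * w i c \<le> e i c * \<delta>"
        using mult_left_mono[OF cost[of i c] e0[of i c]] e_def[of i c]
        by (cases "g i = h c") simp_all
    qed
    also have "\<dots> = \<delta> * (\<Sum>c\<in>C. \<Sum>i\<in>I. e i c)"
      by (subst sum.swap) (simp add: sum_distrib_right mult.commute sum_distrib_left)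
    also have "\<dots> \<le> \<delta> * (\<Sum>c\<in>C. u c)"
      using \<open>0 \<le> \<delta>\<close> cols by (intro mult_left_mono sum_mono)
    finally show "(\<Sum>i\<in>I. \<Sum>c\<in>C. a' i c * w i c) \<le>
        (\<Sum>i\<in>I. \<Sum>c\<in>C. a i c * w i c) + \<delta> * (\<Sum>c\<in>C. m c - (\<Sum>i\<in>I. a i c))"
      by (simp add: a'_def algebra_simps sum.distrib u_def)
  qed
qed

text \<open>In a saturated cell with unmet demand every supplier is exhausted, and all its mass stays in the
cell. The unmet demand is then exactly the demand minus the supply of the cell, however the plan
was built.\<close>

lemma unmet_demand_le:
  fixes a :: "'i \<Rightarrow> 'c \<Rightarrow> real" and g :: "'i \<Rightarrow> 'q" and h :: "'c \<Rightarrow> 'q"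
  assumes fin: "finite I" "finite C"
    and cells: "within_cells I C g h a"
    and sat: "saturated I C s m g h a"
  shows "(\<Sum>c\<in>C. m c - (\<Sum>i\<in>I. a i c)) \<le>
    (\<Sum>q\<in>h ` C. max 0 ((\<Sum>c\<in>{c\<in>C. h c = q}. m c) - (\<Sum>i\<in>{i\<in>I. g i = q}. s i)))"
proof -
  define u where "u c = m c - (\<Sum>i\<in>I. a i c)" for c
  have "(\<Sum>c\<in>C. u c) = (\<Sum>q\<in>h ` C. \<Sum>c\<in>{c\<in>C. h c = q}. u c)"
    using fin by (intro sum.image_gen)
  also have "\<dots> \<le> (\<Sum>q\<in>h ` C. max 0 ((\<Sum>c\<in>{c\<in>C. h c = q}. m c) - (\<Sum>i\<in>{i\<in>I. g i = q}. s i)))"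
  proof (rule sum_mono)
    fix q
    let ?C = "{c\<in>C. h c = q}" and ?I = "{i\<in>I. g i = q}"
    show "sum u ?C \<le> max 0 (sum m ?C - sum s ?I)"
    proof (cases "\<forall>c\<in>?C. u c = 0")
      case True
      then show ?thesis by simp
    next
      case False
      then obtain c where c: "c \<in> C" "h c = q" "(\<Sum>i\<in>I. a i c) \<noteq> m c" by (auto simp: u_def)
      then have full: "(\<Sum>c\<in>C. a i c) = s i" if "i \<in> ?I" for i
        using that sat unfolding saturated_def by blast
      have inC: "(\<Sum>c\<in>C. a i c) = (\<Sum>c\<in>?C. a i c)" if "i \<in> ?I" for i
        using cells that fin by (intro sum.mono_neutral_right) (auto simp: within_cells_def)
      have inI: "(\<Sum>i\<in>I. a i c) = (\<Sum>i\<in>?I. a i c)" if "c \<in> ?C" for c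
        using cells that fin by (intro sum.mono_neutral_right) (auto simp: within_cells_def)
      have "sum s ?I = (\<Sum>i\<in>?I. \<Sum>c\<in>?C. a i c)"
        using full inC by (intro sum.cong) auto
      also have "\<dots> = (\<Sum>c\<in>?C. \<Sum>i\<in>I. a i c)"
        using inI by (subst sum.swap) (auto intro!: sum.cong)
      finally show ?thesis by (simp add: u_def sum_subtractf)
    qed
  qed
  finally show ?thesis by (simp add: u_def)
qed

text \<open>Level \<open>0\<close> is the coarsest, with a single cell, and level \<open>L\<close> is the finest. The plan is saturated
level by level, from \<open>L\<close> down to \<open>0\<close>, by \<open>extend_plan\<close>; the mass that is added at level \<open>k\<close>,
at unit cost at most \<open>\<delta> k\<close>, is the demand that level \<open>k + 1\<close> left unmet. Saturation of
the single cell of level \<open>0\<close> means that all demand is met, as the supply suffices in total.\<close>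

lemma hierarchical_plan:
  fixes w :: "'i \<Rightarrow> 'c \<Rightarrow> real" and g :: "nat \<Rightarrow> 'i \<Rightarrow> 'q" and h :: "nat \<Rightarrow> 'c \<Rightarrow> 'q"
    and \<delta> :: "nat \<Rightarrow> real"
  assumes fin: "finite I" "finite C"
    and s0: "\<And>i. i \<in> I \<Longrightarrow> 0 \<le> s i" and m0: "\<And>c. c \<in> C \<Longrightarrow> 0 \<le> m c"
    and enough: "(\<Sum>c\<in>C. m c) \<le> (\<Sum>i\<in>I. s i)"
    and root: "\<And>i c. i \<in> I \<Longrightarrow> c \<in> C \<Longrightarrow> g 0 i = h 0 c"
    and nested: "\<And>k i c. k < L \<Longrightarrow> i \<in> I \<Longrightarrow> c \<in> C \<Longrightarrow> g (Suc k) i = h (Suc k) c \<Longrightarrow> g k i = h k c"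
    and cost: "\<And>k i c. k \<le> L \<Longrightarrow> i \<in> I \<Longrightarrow> c \<in> C \<Longrightarrow> g k i = h k c \<Longrightarrow> w i c \<le> \<delta> k"
    and \<delta>0: "\<And>k. 0 \<le> \<delta> k"
  obtains a where "partial_plan I C s m a" "\<And>c. c \<in> C \<Longrightarrow> (\<Sum>i\<in>I. a i c) = m c"
    "(\<Sum>i\<in>I. \<Sum>c\<in>C. a i c * w i c) \<le> \<delta> L * (\<Sum>c\<in>C. m c) +
      (\<Sum>k<L. \<delta> k * (\<Sum>q\<in>h (Suc k) ` C.
         max 0 ((\<Sum>c\<in>{c\<in>C. h (Suc k) c = q}. m c) - (\<Sum>i\<in>{i\<in>I. g (Suc k) i = q}. s i))))"
proof -
  define D where "D k = (\<Sum>q\<in>h (Suc k) ` C.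
         max 0 ((\<Sum>c\<in>{c\<in>C. h (Suc k) c = q}. m c) - (\<Sum>i\<in>{i\<in>I. g (Suc k) i = q}. s i)))" for k
  let ?cost = "\<lambda>a. \<Sum>i\<in>I. \<Sum>c\<in>C. a i c * w i c"
  have "\<exists>a. partial_plan I C s m a \<and> within_cells I C (g k) (h k) a \<and>
      saturated I C s m (g k) (h k) a \<and>
      ?cost a \<le> \<delta> L * (\<Sum>c\<in>C. m c) + (\<Sum>j\<in>{k..<L}. \<delta> j * D j)" if "k \<le> L" for k
    using that
  proof (induction k rule: inc_induct)
    case base
    have "partial_plan I C s m (\<lambda>_ _. 0)" "within_cells I C (g L) (h L) (\<lambda>_ _. 0)"
      using s0 m0 by (auto simp: partial_plan_def within_cells_def)
    then obtain a where "partial_plan I C s m a" "within_cells I C (g L) (h L) a"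
      "saturated I C s m (g L) (h L) a"
      "?cost a \<le> (\<Sum>i\<in>I. \<Sum>c\<in>C. 0 * w i c) + \<delta> L * (\<Sum>c\<in>C. m c - (\<Sum>i\<in>I. 0))"
      by (rule extend_plan[OF fin _ _ cost[OF order_refl] \<delta>0[of L]])
    then show ?case by (intro exI[of _ a]) simp
  next
    case (step k)
    then obtain a where a: "partial_plan I C s m a" "within_cells I C (g (Suc k)) (h (Suc k)) a"
      "saturated I C s m (g (Suc k)) (h (Suc k)) a"
      "?cost a \<le> \<delta> L * (\<Sum>c\<in>C. m c) + (\<Sum>j\<in>{Suc k..<L}. \<delta> j * D j)" by blast
    \<comment> \<open>cells of level \<open>k + 1\<close> lie inside cells of level \<open>k\<close>\<close>
    have cells: "within_cells I C (g k) (h k) a"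
      using a(2) nested step.hyps by (auto simp: within_cells_def)
    obtain a' where a': "partial_plan I C s m a'" "within_cells I C (g k) (h k) a'"
      "saturated I C s m (g k) (h k) a'"
      "?cost a' \<le> ?cost a + \<delta> k * (\<Sum>c\<in>C. m c - (\<Sum>i\<in>I. a i c))"
      by (rule extend_plan[OF fin a(1) cells cost[OF less_imp_le[OF step.hyps(2)]] \<delta>0[of k]])
    have "\<delta> k * (\<Sum>c\<in>C. m c - (\<Sum>i\<in>I. a i c)) \<le> \<delta> k * D k"
      unfolding D_def by (intro mult_left_mono unmet_demand_le fin a(2,3) \<delta>0)
    then have "?cost a' \<le> \<delta> L * (\<Sum>c\<in>C. m c) + (\<Sum>j\<in>{k..<L}. \<delta> j * D j)"
      using a(4) a'(4) step.hyps by (simp add: sum.atLeast_Suc_lessThan)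
    with a'(1-3) show ?case by blast
  qed
  then obtain a where a: "partial_plan I C s m a" "saturated I C s m (g 0) (h 0) a"
    "?cost a \<le> \<delta> L * (\<Sum>c\<in>C. m c) + (\<Sum>j\<in>{0..<L}. \<delta> j * D j)" by blast
  have "(\<Sum>i\<in>I. a i c) = m c" if "c \<in> C" for c
  proof (rule ccontr)
    assume ne: "(\<Sum>i\<in>I. a i c) \<noteq> m c"
    have le: "(\<Sum>i\<in>I. a i c) \<le> m c" if "c \<in> C" for c using a(1) that by (auto simp: partial_plan_def)
    have "(\<Sum>c\<in>C. \<Sum>i\<in>I. a i c) < (\<Sum>c\<in>C. m c)"
      using ne that le fin by (intro sum_strict_mono_ex1) (auto simp: less_le)
    moreover have "(\<Sum>i\<in>I. \<Sum>c\<in>C. a i c) = (\<Sum>i\<in>I. s i)"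
      using a(2) root ne that by (intro sum.cong) (auto simp: saturated_def)
    ultimately show False using enough by (subst (asm) sum.swap) simp
  qed
  with a show thesis by (intro that[of a]) (auto simp: D_def lessThan_atLeast0)
qed

section \<open>Transport plans from sample points as trimmings\<close>

lemma epowr_mono:
  assumes "x \<le> y" "0 \<le> r"
  shows "epowr x r \<le> epowr y r"
  using assms
  by (auto simp: epowr_def top_unique less_top intro!: ennreal_leI powr_mono2 enn2real_mono)

text \<open>Domination of measures bounds the density: on the set \<open>A\<close> where \<open>dR/dP\<close> exceeds the constant
\<open>K = 1 / (1 - \<alpha>)\<close>, the integral of \<open>dR/dP - K\<close> over \<open>A\<close> is \<open>R A - K * P A \<le> 0\<close>,
so \<open>A\<close> is a null set.\<close>

lemma trimmings_if_dominated:
  fixes P R :: "'a::euclidean_space measure"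
  assumes "finite_measure P" and P [measurable_cong]: "sets P = sets borel"
    and "prob_space R" and R: "sets R = sets borel"
    and dom: "\<And>A. A \<in> sets borel \<Longrightarrow> emeasure R A \<le> ennreal (1 / (1 - \<alpha>)) * emeasure P A"
  shows "R \<in> trimmings \<alpha> P"
proof -
  interpret finite_measure P by fact
  let ?c = "ennreal (1 / (1 - \<alpha>))" and ?f = "RN_deriv P R"
  have ac: "absolutely_continuous P R"
    using dom P R by (fastforce simp: absolutely_continuous_def null_sets_def)
  have dens: "density P ?f = R"
    using ac P R by (intro density_RN_deriv) auto
  define A where "A = {x \<in> space P. ?f x > ?c}"
  have A [measurable]: "A \<in> sets P" unfolding A_def by measurable
  have "(\<integral>\<^sup>+x. (?f x - ?c) * indicator A x \<partial>P) =
      (\<integral>\<^sup>+x. ?f x * indicator A x - ?c * indicator A x \<partial>P)"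
    by (intro nn_integral_cong) (auto split: split_indicator)
  also have "\<dots> = (\<integral>\<^sup>+x. ?f x * indicator A x \<partial>P) - (\<integral>\<^sup>+x. ?c * indicator A x \<partial>P)"
    by (intro nn_integral_diff)
      (auto simp: nn_integral_cmult_indicator ennreal_mult_eq_top_iff A_def split: split_indicator)
  also have "\<dots> = emeasure R A - ?c * emeasure P A"
    using emeasure_density[of ?f P A] by (simp add: dens nn_integral_cmult_indicator)
  also have "\<dots> = 0"
    using dom[of A] A P prob_space.finite_measure[OF \<open>prob_space R\<close>]
    by (simp add: diff_eq_0_iff_ennreal less_top[symmetric] finite_measure.emeasure_finite)
  finally have "AE x in P. (?f x - ?c) * indicator A x = 0"
    by (subst (asm) nn_integral_0_iff_AE) auto
  then have "AE x in P. ?f x \<le> ?c"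
    by (rule AE_mp) (auto intro!: AE_I2 simp: A_def diff_eq_0_iff_ennreal not_less
        split: split_indicator_asm)
  with ac assms show ?thesis by (simp add: trimmings_def)
qed

text \<open>Here \<open>f i y\<close> is the fraction of the mass at \<open>y\<close> that is received from the sample point \<open>x i\<close>. The
coupling is the image of the measure with density \<open>f\<close> on pairs (index, \<open>y\<close>) under
\<open>(i, y) \<mapsto> (x i, y)\<close>. Working with indices instead of points lets sample points
coincide.\<close>

lemma trimmed_cost_le_assignment:
  fixes x :: "nat \<Rightarrow> 'a::euclidean_space" and f :: "nat \<Rightarrow> 'a \<Rightarrow> ennreal"
  assumes "prob_space Q" and Q [measurable_cong]: "sets Q = sets borel" and n: "n \<ge> 1"
    and "\<alpha> < 1" and "p > 0"
    and f [measurable]: "\<And>i. f i \<in> borel_measurable Q"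
    and total: "AE y in Q. (\<Sum>i=1..n. f i y) = 1"
    and cap: "\<And>i. i \<in> {1..n} \<Longrightarrow> (\<integral>\<^sup>+y. f i y \<partial>Q) \<le> ennreal (1 / ((1 - \<alpha>) * real n))"
  shows "trimmed_cost p \<alpha> (empirical_measure x n) Q \<le>
    epowr (\<Sum>i=1..n. \<integral>\<^sup>+y. f i y * ennreal (norm (x i - y) powr p) \<partial>Q) (1 / p)"
proof -
  interpret Q: prob_space Q by fact
  let ?I = "count_space {1..n}"
  let ?M = "?I \<Otimes>\<^sub>M Q"
  define F where "F = (\<lambda>(i, y). f i y)"
  define T where "T = (\<lambda>(i, y :: 'a). (x i, y))"
  have F [measurable]: "F \<in> borel_measurable ?M"
    unfolding F_def by (rule measurable_pair_measure_countable1) auto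
  have T [measurable]: "T \<in> ?M \<rightarrow>\<^sub>M borel \<Otimes>\<^sub>M borel"
    unfolding T_def by (rule measurable_pair_measure_countable1) auto
  define \<tau> where "\<tau> = distr (density ?M F) (borel \<Otimes>\<^sub>M borel) T"
  have sets_\<tau> [measurable_cong]: "sets \<tau> = sets (borel \<Otimes>\<^sub>M borel)" by (simp add: \<tau>_def)
  have nn_\<tau>: "(\<integral>\<^sup>+z. h z \<partial>\<tau>) = (\<Sum>i=1..n. \<integral>\<^sup>+y. f i y * h (x i, y) \<partial>Q)"
    if h [measurable]: "h \<in> borel_measurable (borel \<Otimes>\<^sub>M borel)" for h
  proof -
    have "(\<integral>\<^sup>+z. h z \<partial>\<tau>) = (\<integral>\<^sup>+z. F z * h (T z) \<partial>?M)"
      unfolding \<tau>_def by (subst nn_integral_distr; (subst nn_integral_density)?; measurable?)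
    also have "\<dots> = (\<integral>\<^sup>+i. \<integral>\<^sup>+y. F (i, y) * h (T (i, y)) \<partial>Q \<partial>?I)"
      by (rule Q.nn_integral_fst[symmetric]) measurable
    also have "\<dots> = (\<Sum>i=1..n. \<integral>\<^sup>+y. f i y * h (x i, y) \<partial>Q)"
      by (simp add: nn_integral_count_space_finite F_def T_def)
    finally show ?thesis .
  qed
  have snd: "distr \<tau> borel snd = Q"
  proof (rule measure_eqI)
    fix A :: "'a set" assume "A \<in> sets (distr \<tau> borel snd)"
    then have A [measurable]: "A \<in> sets borel" by simp
    have "emeasure (distr \<tau> borel snd) A = (\<integral>\<^sup>+z. indicator A (snd z) \<partial>\<tau>)"
      by (simp add: nn_integral_distr nn_integral_indicator[symmetric] del: nn_integral_indicator)
    also have "\<dots> = (\<Sum>i=1..n. \<integral>\<^sup>+y. f i y * indicator A y \<partial>Q)"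
      by (subst nn_\<tau>) simp_all
    also have "\<dots> = (\<integral>\<^sup>+y. (\<Sum>i=1..n. f i y * indicator A y) \<partial>Q)"
      by (rule nn_integral_sum[symmetric]) measurable
    also have "\<dots> = (\<integral>\<^sup>+y. (\<Sum>i=1..n. f i y) * indicator A y \<partial>Q)"
      by (simp only: sum_distrib_right)
    also have "\<dots> = (\<integral>\<^sup>+y. indicator A y \<partial>Q)"
      using total by (intro nn_integral_cong_AE) auto
    finally show "emeasure (distr \<tau> borel snd) A = emeasure Q A" using Q by simp
  qed (simp add: Q)
  have prob_\<tau>: "prob_space \<tau>"
    by (rule prob_space_distrD[of snd _ borel]) (auto simp: snd Q.prob_space_axioms)
  define R where "R = distr \<tau> borel fst"
  have prob_R: "prob_space R"
    unfolding R_def by (intro prob_space.prob_space_distr prob_\<tau>) simp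
  have "\<tau> \<in> couplings R Q"
    by (simp add: couplings_def prob_\<tau> sets_\<tau> snd R_def)
  then have "wasserstein p R Q \<le> epowr (\<integral>\<^sup>+(x, y). ennreal (norm (x - y) powr p) \<partial>\<tau>) (1 / p)"
    unfolding wasserstein_def using \<open>p > 0\<close> by (intro epowr_mono INF_lower) auto
  also have "(\<integral>\<^sup>+(x, y). ennreal (norm (x - y) powr p) \<partial>\<tau>) =
      (\<Sum>i=1..n. \<integral>\<^sup>+y. f i y * ennreal (norm (x i - y) powr p) \<partial>Q)"
    by (subst nn_\<tau>) auto
  finally have cost: "wasserstein p R Q \<le>
    epowr (\<Sum>i=1..n. \<integral>\<^sup>+y. f i y * ennreal (norm (x i - y) powr p) \<partial>Q) (1 / p)" .
  have "R \<in> trimmings \<alpha> (empirical_measure x n)"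
  proof (rule trimmings_if_dominated)
    show "finite_measure (empirical_measure x n)"
      using prob_space_empirical_measure[OF n] by (rule prob_space.finite_measure)
    show "prob_space R" by fact
    fix A :: "'a set" assume A [measurable]: "A \<in> sets borel"
    have "emeasure R A = (\<integral>\<^sup>+z. indicator A (fst z) \<partial>\<tau>)"
      unfolding R_def
      by (simp add: nn_integral_distr nn_integral_indicator[symmetric] del: nn_integral_indicator)
    also have "\<dots> = (\<Sum>i=1..n. (\<integral>\<^sup>+y. f i y \<partial>Q) * indicator A (x i))"
      by (subst nn_\<tau>) (auto simp: nn_integral_multc)
    also have "\<dots> \<le> (\<Sum>i=1..n. ennreal (1 / ((1 - \<alpha>) * real n)) * indicator A (x i))"
      using cap by (intro sum_mono mult_right_mono) auto
    also have "\<dots> = ennreal (1 / (1 - \<alpha>)) * emeasure (empirical_measure x n) A"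
    proof -
      have "ennreal (1 / ((1 - \<alpha>) * real n)) = ennreal (1 / (1 - \<alpha>)) * ennreal (1 / real n)"
        using \<open>\<alpha> < 1\<close> by (simp add: ennreal_mult[symmetric])
      then show ?thesis
        by (simp only: emeasure_empirical_measure[OF A] sum_distrib_left[symmetric]
            emeasure_return[OF A] mult.assoc)
    qed
    finally show "emeasure R A \<le> ennreal (1 / (1 - \<alpha>)) * emeasure (empirical_measure x n) A" .
  qed (simp_all add: R_def)
  then show ?thesis
    unfolding trimmed_cost_def using cost by (rule INF_lower2)
qed

section \<open>Dyadic cells of the unit cube\<close>

text \<open>The half-open dyadic cells of side \<open>2\<^sup>-\<^sup>k\<close> are indexed by integer vectors. Half-open cells
partition the space, so each point has one index on every level, and passing to a coarser level is
integer division of the index.\<close>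

definition dyadic_index :: "nat \<Rightarrow> real ^ 'd \<Rightarrow> 'd \<Rightarrow> int" where
  "dyadic_index k x = (\<lambda>j. \<lfloor>2 ^ k * x $ j\<rfloor>)"

definition unit_indices :: "nat \<Rightarrow> ('d::finite \<Rightarrow> int) set" where
  "unit_indices k = {z. \<forall>j. z j \<in> {0..<2 ^ k}}"

definition coarsen :: "nat \<Rightarrow> ('d \<Rightarrow> int) \<Rightarrow> 'd \<Rightarrow> int" where
  "coarsen m z = (\<lambda>j. z j div 2 ^ m)"

abbreviation cell :: "nat \<Rightarrow> ('d::finite \<Rightarrow> int) \<Rightarrow> (real ^ 'd) set" where
  "cell k z \<equiv> {y. dyadic_index k y = z}"

lemma finite_unit_indices: "finite (unit_indices k :: ('d::finite \<Rightarrow> int) set)"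
  and card_unit_indices: "card (unit_indices k :: ('d::finite \<Rightarrow> int) set) = (2 ^ k) ^ CARD('d)"
proof -
  have eq: "unit_indices k = (UNIV :: 'd set) \<rightarrow>\<^sub>E {0..<2 ^ k :: int}"
    by (auto simp: unit_indices_def PiE_def Pi_def)
  show "finite (unit_indices k :: ('d \<Rightarrow> int) set)"
    unfolding eq by (intro finite_PiE) auto
  show "card (unit_indices k :: ('d \<Rightarrow> int) set) = (2 ^ k) ^ CARD('d)"
    unfolding eq by (subst card_PiE) (auto simp: nat_power_eq)
qed

lemma coarsen_coarsen: "coarsen m (coarsen n z) = coarsen (n + m) z"
  by (simp add: coarsen_def power_add zdiv_zmult2_eq)

lemma dyadic_index_coarsen:
  assumes "k \<le> l"
  shows "dyadic_index k x = coarsen (l - k) (dyadic_index l x)"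
proof
  fix j
  have "(2::real) ^ l = 2 ^ k * 2 ^ (l - k)" using assms by (simp flip: power_add)
  then have eq: "2 ^ k * x $ j = (2 ^ l * x $ j) / real_of_int (2 ^ (l - k))" by simp
  show "dyadic_index k x j = coarsen (l - k) (dyadic_index l x) j"
    unfolding dyadic_index_def coarsen_def
    by (subst eq) (rule floor_divide_real_eq_div, simp)
qed

lemma coarsen_unit_indices:
  assumes "k \<le> l" "z \<in> unit_indices l"
  shows "coarsen (l - k) z \<in> unit_indices k"
proof -
  have "z j div 2 ^ (l - k) < 2 ^ k" for j
  proof (rule ccontr)
    assume "\<not> z j div 2 ^ (l - k) < 2 ^ k"
    then have "2 ^ k * 2 ^ (l - k) \<le> z j div 2 ^ (l - k) * 2 ^ (l - k)"
      by (intro mult_right_mono) auto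
    also have "\<dots> \<le> z j" by (simp add: minus_mod_eq_div_mult[symmetric])
    finally have "\<not> z j < 2 ^ l" using assms by (simp flip: power_add)
    then show False using assms(2) by (auto simp: unit_indices_def)
  qed
  then show ?thesis
    using assms(2) by (auto simp: unit_indices_def coarsen_def pos_imp_zdiv_nonneg_iff)
qed

lemma mem_cell_iff:
  "y \<in> cell k z \<longleftrightarrow> (\<forall>j. real_of_int (z j) / 2 ^ k \<le> y $ j \<and> y $ j < real_of_int (z j) / 2 ^ k + 1 / 2 ^ k)"
  by (auto simp: dyadic_index_def fun_eq_iff floor_eq_iff field_simps)

lemma sets_cell [measurable]: "cell k z \<in> sets (borel :: (real ^ 'd) measure)"
proof -
  have "{y :: real ^ 'd. \<forall>j. real_of_int (z j) / 2 ^ k \<le> y $ j \<and>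
      y $ j < real_of_int (z j) / 2 ^ k + 1 / 2 ^ k} \<in> sets borel"
    by measurable
  moreover have "cell k z = {y :: real ^ 'd. \<forall>j. real_of_int (z j) / 2 ^ k \<le> y $ j \<and>
      y $ j < real_of_int (z j) / 2 ^ k + 1 / 2 ^ k}"
    using mem_cell_iff[of _ k z] by blast
  ultimately show ?thesis by simp
qed

lemma norm_diff_le_same_cell:
  fixes x y :: "real ^ 'd"
  assumes "dyadic_index k x = dyadic_index k y"
  shows "norm (x - y) \<le> real CARD('d) / 2 ^ k"
proof -
  have "\<bar>(x - y) $ j\<bar> \<le> 1 / 2 ^ k" for j
  proof -
    have "x \<in> cell k (dyadic_index k y)" "y \<in> cell k (dyadic_index k y)" using assms by auto
    then show ?thesis unfolding mem_cell_iff
      by (auto dest!: spec[of _ j])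
  qed
  then have "(\<Sum>j\<in>UNIV. \<bar>(x - y) $ j\<bar>) \<le> (\<Sum>j\<in>(UNIV::'d set). 1 / 2 ^ k)"
    by (intro sum_mono) auto
  then show ?thesis using norm_le_l1_cart[of "x - y"] by simp
qed

lemma emeasure_unit_cbox: "emeasure lborel (cbox 0 1 :: (real ^ 'd) set) = 1"
proof -
  have "measure lborel (cbox 0 1 :: (real ^ 'd) set) = 1"
    by (subst content_cbox_cart) (auto simp: interval_eq_empty_cart)
  moreover have "emeasure lborel (cbox 0 1 :: (real ^ 'd) set) \<noteq> \<top>"
    using emeasure_lborel_cbox_finite[of 0 "1 :: real ^ 'd"] by simp
  ultimately show ?thesis by (simp add: emeasure_eq_ennreal_measure)
qed

lemma emeasure_lborel_cell:
  "emeasure lborel (cell k z :: (real ^ 'd) set) = ennreal (1 / (2 ^ k) ^ CARD('d))"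
proof -
  define a b :: "real ^ 'd" where "a = (\<chi> j. real_of_int (z j) / 2 ^ k)"
    and "b = (\<chi> j. real_of_int (z j) / 2 ^ k + 1 / 2 ^ k)"
  have sub: "box a b \<subseteq> cell k z" "cell k z \<subseteq> cbox a b"
    unfolding subset_iff mem_cell_iff by (auto simp: mem_box_cart a_def b_def less_imp_le)
  have "measure lborel (cbox a b) = 1 / (2 ^ k) ^ CARD('d)"
    by (subst content_cbox_cart)
      (auto simp: interval_eq_empty_cart a_def b_def not_less power_one_over)
  moreover have "emeasure lborel (cbox a b) \<noteq> \<top>"
    using emeasure_lborel_cbox_finite[of a b] by simp
  ultimately have cbox: "emeasure lborel (cbox a b) = ennreal (1 / (2 ^ k) ^ CARD('d))"
    by (simp add: emeasure_eq_ennreal_measure)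
  have "emeasure lborel (box a b) = emeasure lborel (cbox a b)"
    by (simp add: emeasure_lborel_box_eq emeasure_lborel_cbox_eq)
  moreover have "emeasure lborel (box a b) \<le> emeasure lborel (cell k z :: (real ^ 'd) set)"
    "emeasure lborel (cell k z :: (real ^ 'd) set) \<le> emeasure lborel (cbox a b)"
    using sub by (auto intro!: emeasure_mono)
  ultimately show ?thesis using cbox by simp
qed

lemma cell_subset_unit_cbox:
  assumes "z \<in> unit_indices k"
  shows "cell k z \<subseteq> cbox 0 (1 :: real ^ 'd)"
proof
  fix y :: "real ^ 'd" assume y: "y \<in> cell k z"
  have "0 \<le> y $ j \<and> y $ j \<le> 1" for j
  proof -
    have j: "real_of_int (z j) / 2 ^ k \<le> y $ j" "y $ j < real_of_int (z j) / 2 ^ k + 1 / 2 ^ k"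
      using y unfolding mem_cell_iff by auto
    have "0 \<le> z j \<and> z j < 2 ^ k" using assms by (simp add: unit_indices_def)
    then have z: "0 \<le> z j" "z j + 1 \<le> 2 ^ k" by linarith+
    then have "real_of_int (z j + 1) \<le> real_of_int (2 ^ k)" by (simp only: of_int_le_iff)
    then have "real_of_int (z j) + 1 \<le> 2 ^ k" by simp
    then have "real_of_int (z j) / 2 ^ k + 1 / 2 ^ k \<le> 1"
      by (simp add: add_divide_distrib[symmetric])
    moreover have "0 \<le> real_of_int (z j) / 2 ^ k" using z by simp
    ultimately show ?thesis using j by linarith
  qed
  then show "y \<in> cbox 0 1" by (simp add: mem_box_cart)
qed

abbreviation cube_measure :: "(real ^ 'd) measure" where
  "cube_measure \<equiv> uniform_measure lborel (cbox 0 1)"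

lemma prob_space_cube_measure: "prob_space (cube_measure :: (real ^ 'd) measure)"
  by (rule prob_space_uniform_measure) (simp_all add: emeasure_unit_cbox)

lemma emeasure_cube_cell:
  assumes "z \<in> unit_indices k"
  shows "emeasure cube_measure (cell k z :: (real ^ 'd) set) = ennreal (1 / (2 ^ k) ^ CARD('d))"
  using cell_subset_unit_cbox[OF assms]
  by (subst emeasure_uniform_measure)
    (simp_all add: emeasure_unit_cbox emeasure_lborel_cell Int_absorb1 divide_ennreal_def)

lemma measure_cube_cell:
  assumes "z \<in> unit_indices k"
  shows "measure cube_measure (cell k z :: (real ^ 'd) set) = 1 / (2 ^ k) ^ CARD('d)"
  using emeasure_cube_cell[OF assms] by (simp add: measure_def)

lemma AE_cube_unit_indices:
  "AE y in (cube_measure :: (real ^ 'd) measure). \<forall>k. dyadic_index k y \<in> unit_indices k"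
proof -
  interpret prob_space "cube_measure :: (real ^ 'd) measure" by (rule prob_space_cube_measure)
  have z: "(\<lambda>_. 0) \<in> (unit_indices 0 :: ('d \<Rightarrow> int) set)" by (simp add: unit_indices_def)
  have "prob (cell 0 (\<lambda>_. 0)) = 1"
    using measure_cube_cell[OF z] by simp
  then have "AE y in (cube_measure :: (real ^ 'd) measure). y \<in> cell 0 (\<lambda>_. 0)"
    by (rule AE_prob_1)
  then show ?thesis
  proof eventually_elim
    case (elim y)
    have y: "0 \<le> y $ j" "y $ j < 1" for j
      using elim unfolding mem_cell_iff by (auto dest: spec[of _ j])
    show ?case
    proof
      fix k
      have "\<lfloor>2 ^ k * y $ j\<rfloor> < 2 ^ k" for j
      proof -
        have "2 ^ k * y $ j < 2 ^ k" using y(2)[of j] by simp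
        then show ?thesis by (simp add: floor_less_iff)
      qed
      then show "dyadic_index k y \<in> unit_indices k"
        using y(1) by (auto simp: unit_indices_def dyadic_index_def)
    qed
  qed
qed

lemma sum_cell_masses_le:
  fixes q :: "'d::finite \<Rightarrow> int"
  assumes "k \<le> l" "q \<in> unit_indices k"
  shows "(\<Sum>z\<in>{z\<in>unit_indices l. coarsen (l - k) z = q}. 1 / (2 ^ l) ^ CARD('d)) \<le>
    (1::real) / (2 ^ k) ^ CARD('d)"
proof -
  interpret prob_space "cube_measure :: (real ^ 'd) measure" by (rule prob_space_cube_measure)
  let ?Z = "{z\<in>unit_indices l. coarsen (l - k) z = q} :: ('d \<Rightarrow> int) set"
  have "(\<Sum>z\<in>?Z. 1 / (2 ^ l) ^ CARD('d)) = (\<Sum>z\<in>?Z. prob (cell l z))"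
    by (intro sum.cong) (auto simp: measure_cube_cell)
  also have "\<dots> = prob (\<Union>z\<in>?Z. cell l z)"
    by (intro finite_measure_finite_Union[symmetric])
      (auto simp: finite_unit_indices disjoint_family_on_def)
  also have "\<dots> \<le> prob (cell k q)"
    using dyadic_index_coarsen[OF assms(1)] by (intro finite_measure_mono) auto
  also have "\<dots> = 1 / (2 ^ k) ^ CARD('d)" by (rule measure_cube_cell[OF assms(2)])
  finally show ?thesis .
qed

section \<open>Cost of the dyadic plan for a fixed sample\<close>

definition cell_deficit :: "(nat \<Rightarrow> real ^ 'd) \<Rightarrow> nat \<Rightarrow> real \<Rightarrow> nat \<Rightarrow> ('d \<Rightarrow> int) \<Rightarrow> real" where
  "cell_deficit x n \<alpha> k q =
     max 0 (1 / (2 ^ k) ^ CARD('d) - real (card {i\<in>{1..n}. x i \<in> cell k q}) / ((1 - \<alpha>) * real n))"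

text \<open>The receivers in \<open>hierarchical_plan\<close> are the cells of level \<open>L\<close>, and a cell spreads what it
receives uniformly over itself. A point and a cell that lie in a common cell of level \<open>k\<close> are at
distance at most \<open>d / 2\<^sup>k\<close> (the bound by the \<open>\<ell>\<^sup>1\<close> norm), which gives the factors
\<open>(d / 2\<^sup>k)\<^sup>p\<close>.\<close>

lemma trimmed_cost_cube_le:
  fixes x :: "nat \<Rightarrow> real ^ 'd"
  assumes n: "n \<ge> 1" and \<alpha>: "0 < \<alpha>" "\<alpha> < 1" and p: "p \<ge> 1"
    and inside: "\<And>i k. i \<in> {1..n} \<Longrightarrow> dyadic_index k (x i) \<in> unit_indices k"
  shows "trimmed_cost p \<alpha> (empirical_measure x n) cube_measure \<le>
    ennreal (((real CARD('d) / 2 ^ L) powr p +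
      (\<Sum>k<L. (real CARD('d) / 2 ^ k) powr p *
        (\<Sum>q\<in>unit_indices (Suc k). cell_deficit x n \<alpha> (Suc k) q))) powr (1 / p))"
proof -
  define I where "I = {1..n}"
  define C where "C = (unit_indices L :: ('d \<Rightarrow> int) set)"
  define \<mu> :: real where "\<mu> = 1 / (2 ^ L) ^ CARD('d)"
  define s :: real where "s = 1 / ((1 - \<alpha>) * real n)"
  define \<delta> where "\<delta> k = (real CARD('d) / 2 ^ k) powr p" for k :: nat
  define g where "g k i = dyadic_index k (x i)" for k i
  define h where "h k c = (coarsen (L - k) c :: 'd \<Rightarrow> int)" for k c
  \<comment> \<open>The smallest \<open>\<delta> k\<close> over the levels \<open>k\<close> on which \<open>x i\<close> and \<open>c\<close> share a cell: this bounds
    the cost of shipping from \<open>x i\<close> to any point of \<open>c\<close>.\<close>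
  define w where "w i c = Min (\<delta> ` {k\<in>{..L}. g k i = h k c})" for i c
  have fin: "finite I" "finite C" by (auto simp: I_def C_def finite_unit_indices)
  have \<mu>0: "\<mu> > 0" by (simp add: \<mu>_def)
  have s0: "s \<ge> 0" using \<alpha> by (simp add: s_def)
  have mass: "(\<Sum>c\<in>C. \<mu>) = 1"
    by (simp add: C_def card_unit_indices \<mu>_def)
  have enough: "(\<Sum>c\<in>C. \<mu>) \<le> (\<Sum>i\<in>I. s)"
    using \<alpha> n unfolding mass by (simp add: I_def s_def field_simps)
  have root: "g 0 i = h 0 c" if "i \<in> I" "c \<in> C" for i c
  proof -
    have "g 0 i \<in> unit_indices 0" "h 0 c \<in> unit_indices 0"
      using that inside[of i 0] coarsen_unit_indices[of 0 L c] by (auto simp: g_def h_def I_def C_def)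
    then have "0 \<le> g 0 i j \<and> g 0 i j < 1 \<and> 0 \<le> h 0 c j \<and> h 0 c j < 1" for j
      by (simp add: unit_indices_def)
    then show ?thesis by (intro ext) (smt (verit))
  qed
  have nested: "g k i = h k c" if "k < L" "g (Suc k) i = h (Suc k) c" for k i c
  proof -
    have "g k i = coarsen 1 (h (Suc k) c)"
      using that(2) dyadic_index_coarsen[of k "Suc k" "x i"] by (simp add: g_def)
    also have "\<dots> = h k c"
      using that(1) by (simp add: h_def coarsen_coarsen Suc_diff_Suc)
    finally show ?thesis .
  qed
  have w_le: "w i c \<le> \<delta> k" if "k \<le> L" "g k i = h k c" for i c k
    unfolding w_def using that by (intro Min_le) auto
  have le_w: "norm (x i - y) powr p \<le> w i c" if "i \<in> I" "c \<in> C" "y \<in> cell L c" for i c y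
  proof -
    have "w i c \<in> \<delta> ` {k\<in>{..L}. g k i = h k c}"
      unfolding w_def using root that by (intro Min_in) auto
    then obtain k where k: "k \<le> L" "g k i = h k c" "w i c = \<delta> k" by auto
    have "dyadic_index k (x i) = dyadic_index k y"
      using k(2) that(3) dyadic_index_coarsen[OF k(1), of y] by (simp add: g_def h_def)
    then have "norm (x i - y) \<le> real CARD('d) / 2 ^ k" by (rule norm_diff_le_same_cell)
    then show ?thesis unfolding k(3) \<delta>_def using p by (intro powr_mono2) auto
  qed
  have w0: "0 \<le> w i c" if "i \<in> I" "c \<in> C" for i c
  proof -
    have "w i c \<in> \<delta> ` {k\<in>{..L}. g k i = h k c}"
      unfolding w_def using root that by (intro Min_in) auto
    then show ?thesis by (auto simp: \<delta>_def)
  qed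
  obtain a where plan: "partial_plan I C (\<lambda>_. s) (\<lambda>_. \<mu>) a"
    and met: "\<And>c. c \<in> C \<Longrightarrow> (\<Sum>i\<in>I. a i c) = \<mu>"
    and cost: "(\<Sum>i\<in>I. \<Sum>c\<in>C. a i c * w i c) \<le> \<delta> L * (\<Sum>c\<in>C. \<mu>) +
      (\<Sum>k<L. \<delta> k * (\<Sum>q\<in>h (Suc k) ` C.
         max 0 ((\<Sum>c\<in>{c\<in>C. h (Suc k) c = q}. \<mu>) - (\<Sum>i\<in>{i\<in>I. g (Suc k) i = q}. s))))"
  proof (rule hierarchical_plan[of I C "\<lambda>_. s" "\<lambda>_. \<mu>" g h L w \<delta>])
    show "0 \<le> \<delta> k" for k by (simp add: \<delta>_def)
  qed (use fin s0 \<mu>0 enough root nested w_le in auto)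
  have a0: "0 \<le> a i c" if "i \<in> I" "c \<in> C" for i c
    using plan that by (auto simp: partial_plan_def)
  define Z where "Z = \<delta> L + (\<Sum>k<L. \<delta> k * (\<Sum>q\<in>unit_indices (Suc k). cell_deficit x n \<alpha> (Suc k) q))"
  have "(\<Sum>q\<in>h (Suc k) ` C.
         max 0 ((\<Sum>c\<in>{c\<in>C. h (Suc k) c = q}. \<mu>) - (\<Sum>i\<in>{i\<in>I. g (Suc k) i = q}. s)))
      \<le> (\<Sum>q\<in>unit_indices (Suc k). cell_deficit x n \<alpha> (Suc k) q)" if "k < L" for k
  proof -
    have sub: "h (Suc k) ` C \<subseteq> unit_indices (Suc k)"
      using that coarsen_unit_indices[of "Suc k" L] by (auto simp: h_def C_def)
    have "max 0 ((\<Sum>c\<in>{c\<in>C. h (Suc k) c = q}. \<mu>) - (\<Sum>i\<in>{i\<in>I. g (Suc k) i = q}. s))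
        \<le> cell_deficit x n \<alpha> (Suc k) q" if "q \<in> h (Suc k) ` C" for q
    proof -
      have "(\<Sum>c\<in>{c\<in>C. h (Suc k) c = q}. \<mu>) \<le> 1 / (2 ^ Suc k) ^ CARD('d)"
        unfolding C_def h_def \<mu>_def using that sub \<open>k < L\<close> by (intro sum_cell_masses_le) auto
      then show ?thesis
        unfolding cell_deficit_def by (simp add: g_def s_def I_def max.coboundedI2)
    qed
    then have "(\<Sum>q\<in>h (Suc k) ` C.
         max 0 ((\<Sum>c\<in>{c\<in>C. h (Suc k) c = q}. \<mu>) - (\<Sum>i\<in>{i\<in>I. g (Suc k) i = q}. s)))
        \<le> (\<Sum>q\<in>h (Suc k) ` C. cell_deficit x n \<alpha> (Suc k) q)"
      by (intro sum_mono)
    also have "\<dots> \<le> (\<Sum>q\<in>unit_indices (Suc k). cell_deficit x n \<alpha> (Suc k) q)"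
      using sub by (intro sum_mono2 finite_unit_indices) (auto simp: cell_deficit_def)
    finally show ?thesis .
  qed
  then have costZ: "(\<Sum>i\<in>I. \<Sum>c\<in>C. a i c * w i c) \<le> Z"
    using cost unfolding mass Z_def
    by (elim order_trans) (auto intro!: sum_mono mult_left_mono simp: \<delta>_def)
  have Z0: "0 \<le> Z"
    using costZ a0 w0 by (intro order_trans[OF _ costZ] sum_nonneg) auto
  \<comment> \<open>On a cell \<open>c\<close> of level \<open>L\<close> the share of \<open>x i\<close> is the constant \<open>a i c / \<mu>\<close>; outside the cube
    it is \<open>0\<close>, which only concerns a null set.\<close>
  define F where "F i y = (\<Sum>c\<in>C. ennreal (a i c / \<mu>) * indicator (cell L c) y)" for i and y :: "real ^ 'd"
  have F: "F i \<in> borel_measurable cube_measure" for i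
    unfolding F_def by measurable
  have cellmass: "emeasure cube_measure (cell L c :: (real ^ 'd) set) = ennreal \<mu>" if "c \<in> C" for c
    using that unfolding C_def \<mu>_def by (rule emeasure_cube_cell)
  have "trimmed_cost p \<alpha> (empirical_measure x n) cube_measure \<le>
    epowr (\<Sum>i=1..n. \<integral>\<^sup>+y. F i y * ennreal (norm (x i - y) powr p) \<partial>cube_measure) (1 / p)"
  proof (rule trimmed_cost_le_assignment[OF prob_space_cube_measure _ n \<alpha>(2) _ F])
    show "AE y in cube_measure. (\<Sum>i=1..n. F i y) = 1"
      using AE_cube_unit_indices
    proof eventually_elim
      case (elim y)
      let ?c = "dyadic_index L y"
      have c: "?c \<in> C" using elim by (simp add: C_def)
      have "F i y = ennreal (a i ?c / \<mu>)" for i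
      proof -
        have "F i y = (\<Sum>c\<in>{?c}. ennreal (a i c / \<mu>) * indicator (cell L c) y)"
          unfolding F_def using c fin by (intro sum.mono_neutral_right) (auto simp: indicator_def)
        then show ?thesis by simp
      qed
      then have "(\<Sum>i\<in>I. F i y) = ennreal (\<Sum>i\<in>I. a i ?c / \<mu>)"
        using a0 c \<mu>0 by simp
      also have "(\<Sum>i\<in>I. a i ?c / \<mu>) = 1"
        using met[OF c] \<mu>0 by (simp add: sum_divide_distrib[symmetric])
      finally show ?case by (simp add: I_def)
    qed
    show "(\<integral>\<^sup>+y. F i y \<partial>cube_measure) \<le> ennreal (1 / ((1 - \<alpha>) * real n))" if i: "i \<in> {1..n}" for i
    proof -
      have i: "i \<in> I" using i by (simp add: I_def)
      have "(\<integral>\<^sup>+y. F i y \<partial>cube_measure) =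
          (\<Sum>c\<in>C. \<integral>\<^sup>+y. ennreal (a i c / \<mu>) * indicator (cell L c) y \<partial>cube_measure)"
        unfolding F_def by (rule nn_integral_sum) measurable
      also have "\<dots> = (\<Sum>c\<in>C. ennreal (a i c))"
      proof (rule sum.cong)
        fix c assume c: "c \<in> C"
        have "(\<integral>\<^sup>+y. ennreal (a i c / \<mu>) * indicator (cell L c) y \<partial>cube_measure) =
            ennreal (a i c / \<mu>) * ennreal \<mu>"
          using c by (subst nn_integral_cmult_indicator) (simp_all only: cellmass, simp)
        then show "(\<integral>\<^sup>+y. ennreal (a i c / \<mu>) * indicator (cell L c) y \<partial>cube_measure) = ennreal (a i c)"
          using a0[OF i c] \<mu>0 by (simp add: ennreal_mult[symmetric])
      qed simp
      also have "\<dots> = ennreal (\<Sum>c\<in>C. a i c)" using a0[OF i] by simp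
      also have "\<dots> \<le> ennreal s"
        using plan i by (intro ennreal_leI) (auto simp: partial_plan_def)
      finally show ?thesis by (simp add: s_def)
    qed
  qed (use p in auto)
  also have "(\<Sum>i=1..n. \<integral>\<^sup>+y. F i y * ennreal (norm (x i - y) powr p) \<partial>cube_measure) \<le>
      (\<Sum>i\<in>I. ennreal (\<Sum>c\<in>C. a i c * w i c))"
    unfolding I_def[symmetric]
  proof (rule sum_mono)
    fix i assume i: "i \<in> I"
    have "(\<integral>\<^sup>+y. F i y * ennreal (norm (x i - y) powr p) \<partial>cube_measure) \<le>
      (\<integral>\<^sup>+y. (\<Sum>c\<in>C. ennreal (a i c / \<mu> * w i c) * indicator (cell L c) y) \<partial>cube_measure)"
    proof (rule nn_integral_mono)
      fix y :: "real ^ 'd"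
      have "F i y * ennreal (norm (x i - y) powr p) =
          (\<Sum>c\<in>C. ennreal (a i c / \<mu>) * ennreal (norm (x i - y) powr p) * indicator (cell L c) y)"
        unfolding F_def sum_distrib_right by (intro sum.cong) (simp_all add: ac_simps)
      also have "\<dots> \<le> (\<Sum>c\<in>C. ennreal (a i c / \<mu> * w i c) * indicator (cell L c) y)"
      proof (rule sum_mono)
        fix c assume c: "c \<in> C"
        have "ennreal (a i c / \<mu>) * ennreal (norm (x i - y) powr p) \<le> ennreal (a i c / \<mu> * w i c)"
          if "y \<in> cell L c"
          using le_w[OF i c that] a0[OF i c] \<mu>0 w0[OF i c]
          by (subst ennreal_mult) (auto intro!: mult_left_mono)
        then show "ennreal (a i c / \<mu>) * ennreal (norm (x i - y) powr p) * indicator (cell L c) y \<le>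
            ennreal (a i c / \<mu> * w i c) * indicator (cell L c) y"
          by (cases "y \<in> cell L c") (simp_all add: indicator_def)
      qed
      finally show "F i y * ennreal (norm (x i - y) powr p) \<le> \<dots>" .
    qed
    also have "\<dots> = (\<Sum>c\<in>C. \<integral>\<^sup>+y. ennreal (a i c / \<mu> * w i c) * indicator (cell L c) y \<partial>cube_measure)"
      by (rule nn_integral_sum) measurable
    also have "\<dots> = (\<Sum>c\<in>C. ennreal (a i c * w i c))"
    proof (rule sum.cong)
      fix c assume c: "c \<in> C"
      have "(\<integral>\<^sup>+y. ennreal (a i c / \<mu> * w i c) * indicator (cell L c) y \<partial>cube_measure) =
          ennreal (a i c / \<mu> * w i c) * ennreal \<mu>"
        using c by (subst nn_integral_cmult_indicator) (simp_all only: cellmass, simp)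
      then show "(\<integral>\<^sup>+y. ennreal (a i c / \<mu> * w i c) * indicator (cell L c) y \<partial>cube_measure) =
          ennreal (a i c * w i c)"
        using a0[OF i c] w0[OF i c] \<mu>0 by (simp add: ennreal_mult[symmetric])
    qed simp
    also have "\<dots> = ennreal (\<Sum>c\<in>C. a i c * w i c)"
      using a0[OF i] w0[OF i] by simp
    finally show "(\<integral>\<^sup>+y. F i y * ennreal (norm (x i - y) powr p) \<partial>cube_measure) \<le>
      ennreal (\<Sum>c\<in>C. a i c * w i c)" .
  qed
  also have "(\<Sum>i\<in>I. ennreal (\<Sum>c\<in>C. a i c * w i c)) = ennreal (\<Sum>i\<in>I. \<Sum>c\<in>C. a i c * w i c)"
    using a0 w0 by (intro sum_ennreal sum_nonneg) auto
  also have "\<dots> \<le> ennreal Z" using costZ by (rule ennreal_leI)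
  also have "epowr (ennreal Z) (1 / p) = ennreal (Z powr (1 / p))"
    using Z0 by (simp add: epowr_def)
  finally show ?thesis
    using p by (simp add: Z_def \<delta>_def epowr_mono)
qed

section \<open>Summing the costs over the levels\<close>

text \<open>The bound is the maximum over \<open>u\<close>, attained at \<open>u = a / c\<close>; it comes from
\<open>ln v \<le> v - 1\<close> for \<open>v = c * u / a\<close>.\<close>

lemma powr_mult_exp_le:
  fixes a c u :: real
  assumes "a > 0" "c > 0" "u > 0"
  shows "u powr a * exp (- c * u) \<le> exp (- a * (1 + ln (c / a)))"
proof -
  have "ln (c * u / a) \<le> c * u / a - 1" using assms by (intro ln_le_minus_one) auto
  moreover have "ln (c * u / a) = ln u + ln (c / a)"
    using assms by (simp add: ln_mult ln_div)
  ultimately have "a * (ln u + ln (c / a)) \<le> a * (c * u / a - 1)"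
    using assms by (intro mult_left_mono) auto
  then have "a * ln u - c * u \<le> - a * (1 + ln (c / a))"
    using assms by (simp add: algebra_simps)
  moreover have "u powr a * exp (- c * u) = exp (a * ln u - c * u)"
    using assms by (simp add: powr_def exp_diff exp_minus field_simps)
  ultimately show ?thesis by simp
qed

lemma ex_power_of_2_bracket:
  fixes r :: real
  assumes "r \<ge> 1"
  obtains L :: nat where "2 ^ L \<le> r" "r < 2 ^ Suc L"
proof -
  define L where "L = nat \<lfloor>log 2 r\<rfloor>"
  have "0 \<le> log 2 r" using assms by simp
  then have L: "real L \<le> log 2 r" "log 2 r < real (Suc L)" by (auto simp: L_def; linarith)+
  show thesis
  proof
    have "2 powr real L \<le> r" using L(1) assms by (simp add: le_log_iff)
    then show "2 ^ L \<le> r" by (simp add: powr_realpow)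
    have "r < 2 powr real (Suc L)" using L(2) assms by (simp only: log_less_iff)
    then show "r < 2 ^ Suc L" by (simp only: powr_realpow)
  qed
qed

text \<open>Here \<open>r\<close> stands for \<open>n\<^sup>1\<^sup>/\<^sup>d\<close>. All \<open>u = r / 2\<^sup>k\<^sup>+\<^sup>1\<close> with \<open>k < L\<close> are at least \<open>1\<close>, so
\<open>u\<^sup>d\<close> in the exponent may be replaced by \<open>u\<close>. By \<open>powr_mult_exp_le\<close> with the exponent
\<open>p + 1\<close> instead of \<open>p\<close> each summand gains a factor \<open>1 / u\<close>, and these factors sum to at
most \<open>2\<close>. The right-hand side does not depend on \<open>r\<close>.\<close>

lemma dyadic_cost_series_le:
  fixes r c p :: real and d :: nat
  assumes r: "r \<ge> 1" and c: "c > 0" and p: "p \<ge> 1" and d: "d \<ge> 1"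
    and L: "2 ^ L \<le> r" "r < 2 ^ Suc L"
  shows "r powr p * ((real d / 2 ^ L) powr p +
      (\<Sum>k<L. (real d / 2 ^ k) powr p * exp (- c * (r / 2 ^ Suc k) ^ d))) \<le>
    (2 * real d) powr p * (1 + 2 * exp (- (p + 1) * (1 + ln (c / (p + 1)))))"
proof -
  define B where "B = exp (- (p + 1) * (1 + ln (c / (p + 1))))"
  have "r powr p * (real d / 2 ^ L) powr p = (real d * (r / 2 ^ L)) powr p"
    using r by (simp add: powr_mult[symmetric] mult.commute)
  also have "\<dots> \<le> (real d * 2) powr p"
    using r p L by (intro powr_mono2 mult_left_mono) (auto simp: field_simps)
  finally have first: "r powr p * (real d / 2 ^ L) powr p \<le> (2 * real d) powr p"
    by (simp add: mult.commute)
  have summand: "r powr p * ((real d / 2 ^ k) powr p * exp (- c * (r / 2 ^ Suc k) ^ d)) \<le>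
      (2 * real d) powr p * (B * (2 ^ Suc k / r))" if "k < L" for k
  proof -
    define u where "u = r / 2 ^ Suc k"
    have "(2::real) ^ Suc k \<le> 2 ^ L" using that by (intro power_increasing) auto
    then have "2 ^ Suc k \<le> r" using L by linarith
    then have u: "u \<ge> 1" by (simp add: u_def del: power_Suc)
    have "r powr p * (real d / 2 ^ k) powr p = (2 * real d * u) powr p"
      using r by (simp add: powr_mult[symmetric] u_def field_simps)
    also have "\<dots> = (2 * real d) powr p * u powr p"
      using u by (simp add: powr_mult)
    finally have eq: "r powr p * ((real d / 2 ^ k) powr p * exp (- c * u ^ d)) =
        (2 * real d) powr p * (u powr p * exp (- c * u ^ d))" by simp
    have "u ^ 1 \<le> u ^ d" using u d by (intro power_increasing) auto
    then have "exp (- c * u ^ d) \<le> exp (- c * u)" using c by simp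
    then have "u powr p * exp (- c * u ^ d) \<le> u powr p * exp (- c * u)"
      by (intro mult_left_mono) auto
    also have "\<dots> = u powr (p + 1) * exp (- c * u) / u"
      using u by (simp add: powr_add)
    also have "\<dots> \<le> B / u"
      unfolding B_def using u c p by (intro divide_right_mono powr_mult_exp_le) auto
    also have "\<dots> = B * (2 ^ Suc k / r)" by (simp add: u_def)
    finally have "u powr p * exp (- c * u ^ d) \<le> B * (2 ^ Suc k / r)" .
    then show ?thesis
      unfolding u_def[symmetric] eq by (intro mult_left_mono) auto
  qed
  have geo: "(\<Sum>k<L. 2 ^ Suc k / r) \<le> 2"
  proof -
    have "(\<Sum>k<L. 2 ^ Suc k / r) = 2 * (\<Sum>k<L. 2 ^ k) / r"
      by (simp add: sum_distrib_left sum_divide_distrib)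
    also have "(\<Sum>k<L. (2::real) ^ k) = 2 ^ L - 1" by (subst sum_gp_strict) simp
    also have "2 * (2 ^ L - 1) / r \<le> 2" using L r by (simp add: field_simps)
    finally show ?thesis .
  qed
  have "r powr p * (\<Sum>k<L. (real d / 2 ^ k) powr p * exp (- c * (r / 2 ^ Suc k) ^ d)) \<le>
      (\<Sum>k<L. (2 * real d) powr p * (B * (2 ^ Suc k / r)))"
    unfolding sum_distrib_left using summand by (intro sum_mono) auto
  also have "\<dots> = (2 * real d) powr p * (B * (\<Sum>k<L. 2 ^ Suc k / r))"
    by (simp only: sum_distrib_left)
  also have "\<dots> \<le> (2 * real d) powr p * (B * 2)"
    using geo by (intro mult_left_mono) (auto simp: B_def)
  finally show ?thesis
    using first unfolding B_def[symmetric] by (simp add: algebra_simps)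
qed

section \<open>Expected deficit of a cell\<close>

text \<open>This is \<open>ln v < v - 1\<close> for \<open>v = 1 / (1 - \<alpha>) \<noteq> 1\<close>; the inequality is strict because
\<open>\<alpha> > 0\<close>.\<close>

lemma chernoff_rate_pos:
  fixes \<alpha> :: real
  assumes "0 < \<alpha>" "\<alpha> < 1"
  shows "0 < \<alpha> + (1 - \<alpha>) * ln (1 - \<alpha>)"
proof -
  have "ln (1 / (1 - \<alpha>)) \<le> 1 / (1 - \<alpha>) - 1" using assms by (intro ln_le_minus_one) auto
  moreover have "ln (1 / (1 - \<alpha>)) \<noteq> 1 / (1 - \<alpha>) - 1"
    using ln_eq_minus_one[of "1 / (1 - \<alpha>)"] assms by auto
  ultimately have "(1 - \<alpha>) * - ln (1 - \<alpha>) < (1 - \<alpha>) * (1 / (1 - \<alpha>) - 1)"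
    using assms by (intro mult_strict_left_mono) (auto simp: ln_div)
  also have "\<dots> = \<alpha>" using assms by (simp add: field_simps)
  finally show ?thesis by simp
qed

lemma card_hits_eq_sum:
  fixes x :: "nat \<Rightarrow> 'b"
  shows "real (card {i\<in>{1..n}. x i \<in> A}) = (\<Sum>i=1..n. indicator A (x i))"
  using sum.inter_filter[of "{1..n}" "\<lambda>_. 1 :: real" "\<lambda>i. x i \<in> A"]
  by (simp add: indicator_def of_bool_def)

context prob_space
begin

lemma measurable_cell_deficit:
  fixes X :: "nat \<Rightarrow> 'a \<Rightarrow> real ^ 'd"
  assumes "\<And>i. i \<ge> 1 \<Longrightarrow> X i \<in> borel_measurable M"
  shows "(\<lambda>\<omega>. cell_deficit (\<lambda>i. X i \<omega>) n \<alpha> k q) \<in> borel_measurable M"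
proof -
  have "(\<lambda>\<omega>. indicator (cell k q) (X i \<omega>) :: real) \<in> borel_measurable M" if "i \<in> {1..n}" for i
    using that by (intro measurable_compose[OF assms borel_measurable_indicator[OF sets_cell]]) simp
  then show ?thesis
    unfolding cell_deficit_def card_hits_eq_sum
    by (intro borel_measurable_max borel_measurable_diff borel_measurable_const
        borel_measurable_divide borel_measurable_sum)
qed

lemma integrable_cell_deficit:
  fixes X :: "nat \<Rightarrow> 'a \<Rightarrow> real ^ 'd"
  assumes "\<And>i. i \<ge> 1 \<Longrightarrow> X i \<in> borel_measurable M" and "\<alpha> < 1"
  shows "integrable M (\<lambda>\<omega>. cell_deficit (\<lambda>i. X i \<omega>) n \<alpha> k q)"
proof (rule integrable_const_bound)
  show "AE \<omega> in M. norm (cell_deficit (\<lambda>i. X i \<omega>) n \<alpha> k q) \<le> 1 / (2 ^ k) ^ CARD('d)"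
    using assms(2) by (auto simp: cell_deficit_def)
qed (rule measurable_cell_deficit[OF assms(1)])

text \<open>Chernoff's method, applied to the deficit itself instead of its probability. With \<open>N\<close> the number of
sample points in the cell and \<open>t = - ln (1 - \<alpha>)\<close>, the deficit is at most
\<open>m * exp (t * ((1 - \<alpha>) * n * m - N))\<close>: it is \<open>0\<close> if the exponent is negative and
at most \<open>m\<close> otherwise. By independence the expectation of
\<open>exp (- t * N) = (1 - \<alpha>)\<^sup>N\<close> is \<open>(1 - \<alpha> * m)\<^sup>n \<le> exp (- \<alpha> * n * m)\<close>. This
value of \<open>t\<close> is the one that optimizes the exponent.\<close>

lemma expectation_cell_deficit_le:
  fixes X :: "nat \<Rightarrow> 'a \<Rightarrow> real ^ 'd"
  assumes \<alpha>: "0 < \<alpha>" "\<alpha> < 1" and n: "n \<ge> 1"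
    and indep: "indep_vars (\<lambda>_. borel) X {1..}"
    and law: "\<And>i. i \<ge> 1 \<Longrightarrow> distr M borel (X i) = cube_measure"
    and q: "q \<in> unit_indices k"
  defines "m \<equiv> 1 / (2 ^ k) ^ CARD('d)"
  shows "expectation (\<lambda>\<omega>. cell_deficit (\<lambda>i. X i \<omega>) n \<alpha> k q) \<le>
    m * exp (- (\<alpha> + (1 - \<alpha>) * ln (1 - \<alpha>)) * (real n * m))"
proof -
  have X [measurable]: "X i \<in> borel_measurable M" if "i \<ge> 1" for i
    using indep that by (auto simp: indep_vars_def)
  define Y where "Y y = (if y \<in> cell k q then 1 - \<alpha> else 1)" for y :: "real ^ 'd"
  have Y [measurable]: "Y \<in> borel_measurable borel" unfolding Y_def by measurable
  \<comment> \<open>the part of \<open>m * exp (t * ((1 - \<alpha>) * n * m - N))\<close> that is not random\<close>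
  define b where "b = m * exp (- ln (1 - \<alpha>) * ((1 - \<alpha>) * (real n * m)))"
  have m0: "m > 0" by (simp add: m_def)
  have b0: "b \<ge> 0" using m0 by (simp add: b_def)
  have pointwise: "cell_deficit x n \<alpha> k q \<le> b * (\<Prod>i=1..n. Y (x i))" for x
  proof -
    define N where "N = card {i\<in>{1..n}. x i \<in> cell k q}"
    have "(\<Prod>i=1..n. Y (x i)) = (1 - \<alpha>) ^ N"
      by (simp add: Y_def prod.If_cases N_def Int_def)
    also have "\<dots> = exp (ln (1 - \<alpha>) * real N)"
      using \<alpha> by (simp add: powr_realpow[symmetric] powr_def mult.commute)
    finally have prod: "b * (\<Prod>i=1..n. Y (x i)) =
        m * exp (- ln (1 - \<alpha>) * ((1 - \<alpha>) * (real n * m) - real N))"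
      by (simp add: b_def exp_add[symmetric] algebra_simps)
    show ?thesis
    proof (cases "m \<le> real N / ((1 - \<alpha>) * real n)")
      case True
      then have "cell_deficit x n \<alpha> k q = 0"
        by (simp add: cell_deficit_def m_def N_def)
      then show ?thesis unfolding prod using m0 by simp
    next
      case False
      then have "real N \<le> (1 - \<alpha>) * (real n * m)"
        using \<alpha> n by (simp add: field_simps)
      then have "0 \<le> - ln (1 - \<alpha>) * ((1 - \<alpha>) * (real n * m) - real N)"
        using \<alpha> by (intro mult_nonneg_nonneg) auto
      then have "m \<le> b * (\<Prod>i=1..n. Y (x i))"
        unfolding prod using m0 by simp
      moreover have "cell_deficit x n \<alpha> k q \<le> m"
        using \<alpha> m0 by (simp add: cell_deficit_def m_def)
      ultimately show ?thesis by linarith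
    qed
  qed
  have indepY: "indep_vars (\<lambda>_. borel) (\<lambda>i \<omega>. Y (X i \<omega>)) {1..n}"
    by (rule indep_vars_compose2[OF indep_vars_subset[OF indep]]) auto
  have intY: "integrable M (\<lambda>\<omega>. Y (X i \<omega>))" if "i \<in> {1..n}" for i
  proof (rule integrable_const_bound[where B = 1])
    have "X i \<in> borel_measurable M" using that X by simp
    then show "(\<lambda>\<omega>. Y (X i \<omega>)) \<in> borel_measurable M" by measurable
  qed (use \<alpha> in \<open>auto simp: Y_def\<close>)
  have EY: "expectation (\<lambda>\<omega>. Y (X i \<omega>)) = 1 - \<alpha> * m" if "i \<in> {1..n}" for i
  proof -
    interpret C: prob_space "cube_measure :: (real ^ 'd) measure" by (rule prob_space_cube_measure)
    have [simp]: "C.prob UNIV = 1" using C.prob_space by simp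
    have "expectation (\<lambda>\<omega>. Y (X i \<omega>)) = (\<integral>y. Y y \<partial>distr M borel (X i))"
      using that by (subst integral_distr) auto
    also have "\<dots> = (\<integral>y. 1 - \<alpha> * indicator (cell k q) y \<partial>cube_measure)"
      using that by (simp only: law atLeastAtMost_iff) (auto intro!: Bochner_Integration.integral_cong simp: Y_def)
    also have "\<dots> = 1 - \<alpha> * m"
      by (subst Bochner_Integration.integral_diff)
        (auto simp: C.prob_space m_def measure_cube_cell[OF q] intro!: C.integrable_const_bound[of _ 1])
    finally show ?thesis .
  qed
  have "expectation (\<lambda>\<omega>. cell_deficit (\<lambda>i. X i \<omega>) n \<alpha> k q) \<le>
      expectation (\<lambda>\<omega>. b * (\<Prod>i=1..n. Y (X i \<omega>)))"
    by (intro integral_mono integrable_cell_deficit X \<alpha>(2) pointwise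
        integrable_mult_right indep_vars_integrable indepY intY) auto
  also have "\<dots> = b * (\<Prod>i=1..n. expectation (\<lambda>\<omega>. Y (X i \<omega>)))"
    using indep_vars_lebesgue_integral[OF _ indepY intY] by simp
  also have "\<dots> = b * (1 - \<alpha> * m) ^ n" by (simp add: EY)
  also have "\<dots> \<le> b * exp (- \<alpha> * m) ^ n"
  proof -
    have "m \<le> 1" by (simp add: m_def)
    then have "\<alpha> * m \<le> 1" using \<alpha> m0 by (intro mult_le_one) auto
    moreover have "1 - \<alpha> * m \<le> exp (- \<alpha> * m)" using exp_ge_add_one_self[of "- \<alpha> * m"] by simp
    ultimately show ?thesis using b0 by (intro mult_left_mono power_mono) auto
  qed
  also have "\<dots> = m * exp (- (\<alpha> + (1 - \<alpha>) * ln (1 - \<alpha>)) * (real n * m))"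
    by (simp add: b_def exp_of_nat_mult[symmetric] exp_add[symmetric] algebra_simps)
  finally show ?thesis .
qed

end

section \<open>The rate of convergence\<close>

theorem theorem3p5:
  fixes p \<alpha> :: real
    and P :: "(real ^ 'd) measure"
    and \<Omega> :: "'w measure"
    and X :: "nat \<Rightarrow> 'w \<Rightarrow> real ^ 'd"
  assumes "p \<ge> 1" and "0 < \<alpha>" and "\<alpha> < 1"
    and "P = uniform_measure lborel (cbox 0 1)"
    and "prob_space \<Omega>"
    and "prob_space.indep_vars \<Omega> (\<lambda>_. borel) X {1..}"
    and "\<And>i. i \<ge> 1 \<Longrightarrow> distr \<Omega> borel (X i) = P"
  shows "\<forall>\<epsilon>>0. \<exists>(M::real) n\<^sub>0. \<forall>n\<ge>n\<^sub>0.
    measure \<Omega> {\<omega> \<in> space \<Omega>.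
      ennreal (real n powr (1 / real CARD('d))) *
        trimmed_cost p \<alpha> (empirical_measure (\<lambda>i. X i \<omega>) n) P > ennreal M} \<le> \<epsilon>"
proof (intro allI impI)
  fix \<epsilon> :: real assume \<epsilon>: "\<epsilon> > 0"
  interpret prob_space \<Omega> by fact
  note p = \<open>p \<ge> 1\<close> and \<alpha> = \<open>0 < \<alpha>\<close> \<open>\<alpha> < 1\<close> and P = \<open>P = cube_measure\<close>
    and indep = \<open>indep_vars (\<lambda>_. borel) X {1..}\<close>
  have law: "distr \<Omega> borel (X i) = cube_measure" if "i \<ge> 1" for i
    using assms(7)[OF that] P by simp
  have X [measurable]: "X i \<in> borel_measurable \<Omega>" if "i \<ge> 1" for i
    using indep that by (auto simp: indep_vars_def)
  define c where "c = \<alpha> + (1 - \<alpha>) * ln (1 - \<alpha>)"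
  have c: "c > 0" unfolding c_def by (rule chernoff_rate_pos[OF \<alpha>])
  define d where "d = CARD('d)"
  have d: "d \<ge> 1" by (simp add: d_def Suc_le_eq)
  define B where "B = (2 * real d) powr p * (1 + 2 * exp (- (p + 1) * (1 + ln (c / (p + 1)))))"
  have B: "B > 0" unfolding B_def using d by (intro mult_pos_pos add_pos_pos) auto
  \<comment> \<open>\<open>B\<close> will bound the mean of \<open>r\<^sup>p * Z\<close>, where \<open>Z\<close> dominates the \<open>p\<close>-th power of the trimmed
    cost and \<open>r = n\<^sup>1\<^sup>/\<^sup>d\<close>; Markov's inequality at the threshold \<open>M\<^sup>p = B / \<epsilon>\<close> gives probability at most \<open>\<epsilon>\<close>.\<close>
  define M where "M = (B / \<epsilon>) powr (1 / p)"
  have M: "M powr p = B / \<epsilon>" using p B \<epsilon> by (simp add: M_def powr_powr)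
  have M0: "M \<ge> 0" by (simp add: M_def)
  show "\<exists>(M::real) n\<^sub>0. \<forall>n\<ge>n\<^sub>0. prob {\<omega> \<in> space \<Omega>.
      ennreal (real n powr (1 / real CARD('d))) *
        trimmed_cost p \<alpha> (empirical_measure (\<lambda>i. X i \<omega>) n) P > ennreal M} \<le> \<epsilon>"
  proof (intro exI[of _ M] exI[of _ "1::nat"] allI impI)
    fix n :: nat assume n: "n \<ge> 1"
    define r where "r = real n powr (1 / real d)"
    have r: "r \<ge> 1" using n by (simp add: r_def ge_one_powr_ge_zero)
    have rd: "r ^ d = real n"
      using n d r by (simp add: r_def powr_realpow[symmetric] powr_powr)
    obtain L where L: "2 ^ L \<le> r" "r < 2 ^ Suc L" by (rule ex_power_of_2_bracket[OF r])
    define Z where "Z \<omega> = (real d / 2 ^ L) powr p + (\<Sum>k<L. (real d / 2 ^ k) powr p *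
        (\<Sum>q\<in>unit_indices (Suc k). cell_deficit (\<lambda>i. X i \<omega>) n \<alpha> (Suc k) q))" for \<omega>
    have Z0: "Z \<omega> \<ge> 0" for \<omega>
      unfolding Z_def by (intro add_nonneg_nonneg sum_nonneg mult_nonneg_nonneg)
        (auto simp: cell_deficit_def)
    have int: "integrable \<Omega> (\<lambda>\<omega>. cell_deficit (\<lambda>i. X i \<omega>) n \<alpha> k q)" for k q
      by (rule integrable_cell_deficit[OF X \<alpha>(2)])
    have level: "expectation (\<lambda>\<omega>. \<Sum>q\<in>unit_indices (Suc k). cell_deficit (\<lambda>i. X i \<omega>) n \<alpha> (Suc k) q) \<le>
        exp (- c * (r / 2 ^ Suc k) ^ d)" for k
    proof -
      define m :: real where "m = 1 / (2 ^ Suc k) ^ d"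
      have "expectation (\<lambda>\<omega>. \<Sum>q\<in>unit_indices (Suc k). cell_deficit (\<lambda>i. X i \<omega>) n \<alpha> (Suc k) q) =
          (\<Sum>q\<in>unit_indices (Suc k). expectation (\<lambda>\<omega>. cell_deficit (\<lambda>i. X i \<omega>) n \<alpha> (Suc k) q))"
        by (rule Bochner_Integration.integral_sum) (rule int)
      also have "\<dots> \<le> (\<Sum>q\<in>(unit_indices (Suc k) :: ('d \<Rightarrow> int) set). m * exp (- c * (real n * m)))"
        unfolding m_def c_def d_def
        by (intro sum_mono expectation_cell_deficit_le[OF \<alpha> n indep law])
      also have "\<dots> = exp (- c * (real n * m))"
        by (simp add: card_unit_indices m_def d_def del: power_Suc)
      also have "real n * m = (r / 2 ^ Suc k) ^ d"
        by (simp add: m_def rd[symmetric] power_divide del: power_Suc)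
      finally show ?thesis .
    qed
    define D where "D k \<omega> =
      (\<Sum>q\<in>unit_indices (Suc k). cell_deficit (\<lambda>i. X i \<omega>) n \<alpha> (Suc k) q)" for k \<omega>
    have intD: "integrable \<Omega> (D k)" for k
      unfolding D_def by (intro Bochner_Integration.integrable_sum int)
    have Z: "Z = (\<lambda>\<omega>. (real d / 2 ^ L) powr p + (\<Sum>k<L. (real d / 2 ^ k) powr p * D k \<omega>))"
      by (simp add: Z_def D_def fun_eq_iff)
    have intZ: "integrable \<Omega> Z"
      unfolding Z by (intro Bochner_Integration.integrable_add integrable_const
          Bochner_Integration.integrable_sum integrable_mult_right intD)
    have "expectation Z = (real d / 2 ^ L) powr p + (\<Sum>k<L. (real d / 2 ^ k) powr p * expectation (D k))"
      unfolding Z using intD by (simp add: prob_space)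
    also have "\<dots> \<le> (real d / 2 ^ L) powr p +
        (\<Sum>k<L. (real d / 2 ^ k) powr p * exp (- c * (r / 2 ^ Suc k) ^ d))"
      by (intro add_left_mono sum_mono mult_left_mono level[folded D_def]) auto
    finally have "r powr p * expectation Z \<le> r powr p * \<dots>"
      by (intro mult_left_mono) auto
    also have "\<dots> \<le> B" unfolding B_def by (rule dyadic_cost_series_le[OF r c p d L])
    finally have EZ: "expectation (\<lambda>\<omega>. r powr p * Z \<omega>) \<le> B" by simp
    have inside: "AE \<omega> in \<Omega>. \<forall>k. dyadic_index k (X i \<omega>) \<in> unit_indices k" if "i \<ge> 1" for i
    proof -
      have "AE y in distr \<Omega> borel (X i). \<forall>k. dyadic_index k y \<in> unit_indices k"
        unfolding law[OF that] by (rule AE_cube_unit_indices)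
      then show ?thesis using X[OF that] by (rule AE_distrD[rotated])
    qed
    then have inside: "AE \<omega> in \<Omega>. \<forall>i\<in>{1..n}. \<forall>k. dyadic_index k (X i \<omega>) \<in> unit_indices k"
      by (intro AE_finite_allI) auto
    let ?bad = "{\<omega> \<in> space \<Omega>. ennreal (real n powr (1 / real CARD('d))) *
        trimmed_cost p \<alpha> (empirical_measure (\<lambda>i. X i \<omega>) n) P > ennreal M}"
    let ?big = "{\<omega> \<in> space \<Omega>. r powr p * Z \<omega> \<ge> B / \<epsilon>}"
    have [measurable]: "Z \<in> borel_measurable \<Omega>" using intZ by simp
    have "AE \<omega> in \<Omega>. \<omega> \<in> ?bad \<longrightarrow> \<omega> \<in> ?big"
      using inside
    proof eventually_elim
      case (elim \<omega>)
      show ?case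
      proof
        assume bad: "\<omega> \<in> ?bad"
        have "trimmed_cost p \<alpha> (empirical_measure (\<lambda>i. X i \<omega>) n) P \<le> ennreal (Z \<omega> powr (1 / p))"
          unfolding P Z_def d_def
          using elim by (intro trimmed_cost_cube_le n \<alpha> p) auto
        then have "ennreal r * trimmed_cost p \<alpha> (empirical_measure (\<lambda>i. X i \<omega>) n) P \<le>
            ennreal r * ennreal (Z \<omega> powr (1 / p))"
          by (intro mult_left_mono) auto
        with bad have "ennreal M < ennreal (r * Z \<omega> powr (1 / p))"
          using r by (auto simp: r_def d_def ennreal_mult elim: less_le_trans)
        then have "M < r * Z \<omega> powr (1 / p)" using M0 by (simp add: ennreal_less_iff)
        then have "M powr p \<le> (r * Z \<omega> powr (1 / p)) powr p"
          using M0 p by (intro powr_mono2) auto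
        also have "\<dots> = r powr p * Z \<omega>"
          using r Z0[of \<omega>] p by (simp add: powr_mult powr_powr)
        finally show "\<omega> \<in> ?big" using bad by (simp add: M)
      qed
    qed
    \<comment> \<open>If \<open>?bad\<close> is not an event, its measure is \<open>0\<close> by convention and the bound is trivial.\<close>
    moreover have "?big \<in> events" by measurable
    ultimately have "prob ?bad \<le> prob ?big" by (rule finite_measure_mono_AE)
    also have "\<dots> \<le> expectation (\<lambda>\<omega>. r powr p * Z \<omega>) / (B / \<epsilon>)"
      by (rule integral_Markov_inequality_measure[where A = "space \<Omega>"])
        (use intZ Z0 B \<epsilon> in auto)
    also have "\<dots> \<le> B / (B / \<epsilon>)"
      using EZ B \<epsilon> by (intro divide_right_mono) auto
    also have "\<dots> = \<epsilon>" using B by simp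
    finally show "prob ?bad \<le> \<epsilon>" .
  qed
qed

end
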